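(* Let $W$ be the meromorphic function on $\mathbb{C}$ given by $W(s)=2^s\pi^{s-1}\sin\left(\frac{\pi s}{2}\right)\Gamma(1-s)$. Then $W$ maps the line $\{\tfrac12+it : t\in\mathbb{R}\}$ onto the unit circle $\{w\in\mathbb{C} : |w|=1\}$.
   Context: $\Gamma$ is the Euler Gamma function, and $W$ is regarded as a meromorphic function, with removable singularities removed. *)

theory Defs
  imports "HOL-Complex_Analysis.Complex_Analysis"
begin

(* The defining formula, taken literally, has the junk value 0 at s = 1, 2, 3, ..., where Gamma (1 - s)
   has its poles.  At even s > 0 the zero of the sine cancels the pole, and remove_sings fills in the
   limit there; at odd s > 0 a genuine pole remains, and remove_sings assigns the value 0. *)
definition W :: "complex \<Rightarrow> complex" where
  "W = remove_sings (\<lambda>s. 2 powr s * of_real pi powr (s - 1) * sin (of_real pi * s / 2) * Gamma (1 - s))"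

end

(* On the critical line |W| = 1, by the reflection formula for Gamma together with
   Gamma (1 - s) = cnj (Gamma s).  Writing W (1/2 + i t) = cis (phase t), the sine contributes a
   bounded amount to the continuous function phase, while the rest has derivative
   ln (2 pi) - Re (Digamma (1/2 - i t)), which tends to minus infinity because the real part of
   Digamma exceeds Digamma (1/2) by at least half a harmonic number.  So phase is unbounded below
   and, by the intermediate value theorem, takes values in every residue class modulo 2 pi. *)
theory Submission
  imports Defs
begin

text \<open>By the limit formula for Digamma, the difference of the two values is the sum of the
  terms \<open>d n\<close> below. All are nonnegative, and each of the first \<open>N\<close> is at
  least half a term of the harmonic sum, because there \<open>n + 1/2\<close> is at most
  \<open>\<bar>t\<bar>\<close>.\<close>

lemma Re_Digamma_ge_harm:
  fixes t :: real
  assumes "real N \<le> \<bar>t\<bar>"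
  shows "Re (Digamma (1/2 + \<i> * of_real t)) \<ge> Digamma (1/2 :: real) + harm N / 2"
proof -
  define z where "z = 1/2 + \<i> * of_real t"
  have Re_inv: "Re (inverse (z + of_nat n)) = (n + 1/2) / ((n + 1/2)^2 + t^2)" for n
    by (simp add: z_def Re_divide inverse_eq_divide add_ac)
  define d where "d n = inverse (1/2 + real n) - Re (inverse (z + of_nat n))" for n
  have d_nonneg: "d n \<ge> 0" for n
  proof -
    have "(n + 1/2) / ((n + 1/2)^2 + t^2) \<le> (n + 1/2) / ((real n + 1/2)^2)"
      by (intro divide_left_mono mult_pos_pos add_pos_nonneg) auto
    also have "\<dots> = inverse (1/2 + real n)"
      by (simp add: power2_eq_square add_ac inverse_eq_divide)
    finally show ?thesis by (simp add: d_def Re_inv del: inverse_complex.sel)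
  qed
  have d_ge: "d n \<ge> inverse (real (Suc n)) / 2" if "n < N" for n
  proof -
    define x where "x = real n + 1/2"
    have x: "0 < x" "x \<le> \<bar>t\<bar>" "x \<le> real (Suc n)"
      using that assms by (auto simp: x_def)
    then have "x^2 \<le> t^2"
      by (metis abs_le_square_iff abs_of_pos)
    \<comment> \<open>Replacing \<open>t^2\<close> by the smaller \<open>x^2\<close> enlarges the
      fraction to exactly half of \<open>inverse x\<close>, so \<open>d n\<close> keeps at least the
      other half.\<close>
    have "x / (x^2 + t^2) \<le> x / (x^2 + x^2)"
      using x \<open>x^2 \<le> t^2\<close> by (intro divide_left_mono mult_pos_pos add_pos_nonneg) auto
    also have "\<dots> = inverse x / 2"
      using x by (simp add: field_simps power2_eq_square)
    finally have "inverse x / 2 \<le> inverse x - x / (x^2 + t^2)"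
      by linarith
    moreover have "inverse (real (Suc n)) \<le> inverse x"
      using x by (intro le_imp_inverse_le) auto
    moreover have "d n = inverse x - x / (x^2 + t^2)"
      by (simp add: d_def Re_inv x_def add.commute del: inverse_complex.sel)
    ultimately show ?thesis
      by linarith
  qed
  have "z \<noteq> 0"
    by (simp add: z_def complex_eq_iff)
  \<comment> \<open>The two \<open>ln m\<close> cancel, which leaves the partial sums of
    \<open>d\<close>; their lower bound for \<open>m \<ge> N\<close> passes to the limit.\<close>
  have lim: "(\<lambda>m. Re (of_real (ln (real m)) - (\<Sum>n<m. inverse (z + of_nat n))) -
                  (of_real (ln (real m)) - (\<Sum>n<m. inverse (1/2 + real n))))
         \<longlonglongrightarrow> Re (Digamma z) - Digamma (1/2)"
    by (intro tendsto_diff tendsto_Re Digamma_LIMSEQ \<open>z \<noteq> 0\<close>) auto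
  have "harm N / 2 \<le> Re (Digamma z) - Digamma (1/2)"
  proof (rule tendsto_lowerbound[OF lim])
    show "\<forall>\<^sub>F m in sequentially. harm N / 2 \<le> Re (of_real (ln (real m)) - (\<Sum>n<m. inverse (z + of_nat n))) -
                  (of_real (ln (real m)) - (\<Sum>n<m. inverse (1/2 + real n)))"
      using eventually_ge_at_top[of N]
    proof eventually_elim
      case (elim m)
      have "harm N / 2 \<le> (\<Sum>n<N. d n)"
        unfolding harm_altdef sum_divide_distrib by (intro sum_mono d_ge) auto
      also have "\<dots> \<le> (\<Sum>n<m. d n)"
        using elim by (intro sum_mono2) (auto simp: d_nonneg)
      also have "\<dots> = Re (of_real (ln (real m)) - (\<Sum>n<m. inverse (z + of_nat n))) -
                  (of_real (ln (real m)) - (\<Sum>n<m. inverse (1/2 + real n)))"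
        by (simp add: d_def sum_subtractf Re_sum del: inverse_complex.sel)
      finally show ?case .
    qed
  qed auto
  then show ?thesis
    unfolding z_def by linarith
qed

text \<open>From \<open>T\<close> on, \<open>f t + t\<close> is nonincreasing, which keeps
  \<open>f\<close> below a line of slope -1.\<close>

lemma filterlim_at_bot_if_deriv_le:
  fixes f f' :: "real \<Rightarrow> real"
  assumes "\<And>t. (f has_real_derivative f' t) (at t)"
    and "\<And>t. t \<ge> T \<Longrightarrow> f' t \<le> - 1"
  shows "filterlim f at_bot at_top"
proof (rule filterlim_at_bot_mono)
  show "filterlim (\<lambda>t. f T + T - t) at_bot at_top"
    by real_asymp
  have "f t \<le> f T + T - t" if "t \<ge> T" for t
  proof -
    have "f t + t \<le> f T + T"
      by (rule DERIV_nonpos_imp_nonincreasing[OF that, of "\<lambda>x. f x + x"])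
         (use assms in \<open>force intro!: exI[of _ "f' _ + 1"] derivative_intros\<close>)
    then show ?thesis by simp
  qed
  then show "\<forall>\<^sub>F t in at_top. f t \<le> f T + T - t"
    by (auto simp: eventually_at_top_linorder)
qed

text \<open>The real part is \<open>sin (pi / 4) * cosh (pi * t / 2)\<close>. Its sign keeps the
  sine nonzero and off the branch cut, so that its \<open>Arg\<close> is continuous in
  \<open>t\<close>.\<close>

lemma Re_sin_critical_line_pos: "Re (sin (of_real pi * (1/2 + \<i> * of_real t) / 2)) > 0"
proof -
  have "sin (pi / 4) > 0" by (simp add: sin_45)
  then show ?thesis
    by (simp add: Re_sin add_pos_pos)
qed

text \<open>On the line \<open>1 - s = cnj s\<close>, so the reflection that swaps sine and cosine
  acts on \<open>of_real pi * s / 2\<close> as conjugation.\<close>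

lemma norm_sin_critical_line:
  fixes t :: real
  defines "s \<equiv> 1/2 + \<i> * of_real t"
  shows "cmod (sin (of_real pi * s / 2)) = cmod (cos (of_real pi * s / 2))"
proof -
  have "cos (of_real pi * s / 2) = sin (of_real pi / 2 - of_real pi * s / 2)"
    by (simp add: sin_diff)
  also have "of_real pi / 2 - of_real pi * s / 2 = cnj (of_real pi * s / 2)"
    by (simp add: s_def complex_eq_iff)
  also have "sin \<dots> = cnj (sin (of_real pi * s / 2))"
    by (simp add: cnj_sin)
  finally show ?thesis by simp
qed

lemma nonpos_Ints_Re_le: "z \<in> \<int>\<^sub>\<le>\<^sub>0 \<Longrightarrow> Re z \<le> 0"
  by (auto elim!: nonpos_Ints_cases)

text \<open>Since \<open>1 - s\<close> has real part 1/2, it avoids the poles of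
  \<open>Gamma\<close>; the formula is analytic at \<open>s\<close> and \<open>remove_sings\<close>
  leaves its value alone.\<close>

lemma W_critical_line:
  fixes t :: real
  defines "s \<equiv> 1/2 + \<i> * of_real t"
  shows "W s = 2 powr s * of_real pi powr (s - 1) * sin (of_real pi * s / 2) * Gamma (1 - s)"
  unfolding W_def
proof (rule remove_sings_at_analytic)
  have "1 - s \<notin> \<int>\<^sub>\<le>\<^sub>0"
    using nonpos_Ints_Re_le[of "1 - s"] by (auto simp: s_def)
  then show "(\<lambda>s. 2 powr s * of_real pi powr (s - 1) * sin (of_real pi * s / 2) * Gamma (1 - s)) analytic_on {s}"
    using pi_gt_zero by (auto intro!: analytic_intros simp del: pi_gt_zero simp: not_le)
qed

lemma norm_W_critical_line: "cmod (W (1/2 + \<i> * of_real t)) = 1"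
proof -
  define s where "s = 1/2 + \<i> * of_real t"
  define \<sigma> where "\<sigma> = cmod (sin (of_real pi * s / 2))"
  have "\<sigma> > 0"
    using Re_sin_critical_line_pos[of t] by (auto simp: \<sigma>_def s_def)
  have "s = cnj (1 - s)"
    by (simp add: s_def complex_eq_iff)
  then have "Gamma s = cnj (Gamma (1 - s))"
    by (metis cnj_Gamma)
  then have Gamma_s: "cmod (Gamma s) = cmod (Gamma (1 - s))"
    by simp
  have "sin (of_real pi * s) = 2 * sin (of_real pi * s / 2) * cos (of_real pi * s / 2)"
    using sin_double[of "of_real pi * s / 2"] by simp
  then have "cmod (sin (of_real pi * s)) = 2 * \<sigma>\<^sup>2"
    using norm_sin_critical_line[of t] by (simp add: norm_mult \<sigma>_def s_def power2_eq_square)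
  moreover have "cmod (Gamma s * Gamma (1 - s)) = cmod (of_real pi / sin (of_real pi * s))"
    by (subst Gamma_reflection_complex) simp
  ultimately have "(cmod (Gamma (1 - s)))\<^sup>2 = pi / (2 * \<sigma>\<^sup>2)"
    by (simp add: norm_mult norm_divide Gamma_s power2_eq_square)
  moreover have "(cmod (2 powr s))\<^sup>2 = 2"
    by (simp add: norm_powr_real_powr s_def powr_half_sqrt)
  moreover have "cmod (of_real pi powr (s - 1)) = pi powr (- 1/2)"
    by (simp add: norm_powr_real_powr s_def)
  then have "(cmod (of_real pi powr (s - 1)))\<^sup>2 = 1 / pi"
    by (simp add: powr_minus_divide powr_half_sqrt power_divide)
  \<comment> \<open>The squared moduli of the four factors are 2, 1/pi,
    \<open>\<sigma>\<^sup>2\<close> and \<open>pi / (2 * \<sigma>\<^sup>2)\<close>.\<close>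
  ultimately have "(cmod (W s))\<^sup>2 = 1"
    using \<open>\<sigma> > 0\<close>
    by (simp add: W_critical_line[of t, folded s_def] norm_mult power_mult_distrib flip: \<sigma>_def)
  then show ?thesis
    using power2_eq_1_iff[of "cmod (W s)"] norm_ge_zero[of "W s"] by (auto simp: s_def simp del: norm_ge_zero)
qed

text \<open>A continuous argument of \<open>W\<close> along the line, equal to -2 times the
  Riemann-Siegel theta function. Using \<open>ln_Gamma\<close> rather than \<open>Arg\<close> of
  \<open>Gamma\<close> avoids jumps by 2 pi.\<close>

definition phase :: "real \<Rightarrow> real" where
  "phase t = t * ln (2 * pi) + Im (ln_Gamma (1/2 - \<i> * of_real t))
     + Arg (sin (of_real pi * (1/2 + \<i> * of_real t) / 2))"

lemma W_critical_line_eq_cis: "W (1/2 + \<i> * of_real t) = cis (phase t)"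
proof -
  define s where "s = 1/2 + \<i> * of_real t"
  define S where "S = sin (of_real pi * s / 2)"
  \<comment> \<open>A logarithm of \<open>W s\<close> built factor by factor; its real part vanishes
    because \<open>W s\<close> has modulus 1.\<close>
  define L where "L = s * Ln 2 + (s - 1) * Ln (of_real pi) + Ln S + ln_Gamma (1 - s)"
  have "S \<noteq> 0"
    using Re_sin_critical_line_pos[of t] by (auto simp: S_def s_def)
  have "1 - s \<notin> \<int>\<^sub>\<le>\<^sub>0"
    using nonpos_Ints_Re_le[of "1 - s"] by (auto simp: s_def)
  then have WL: "W s = exp L"
    using \<open>S \<noteq> 0\<close>
    by (simp add: W_critical_line[of t, folded s_def] L_def exp_add powr_def Gamma_complex_altdef flip: S_def)
  have "Ln 2 = of_real (ln 2)"
    using Ln_of_real[of 2] by simp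
  moreover have "1 - s = 1/2 - \<i> * of_real t"
    by (simp add: s_def)
  ultimately have "Im L = phase t"
    using \<open>S \<noteq> 0\<close>
    by (simp add: L_def phase_def s_def S_def Ln_of_real Arg_def ln_mult algebra_simps)
  moreover have "Re L = 0"
    using norm_W_critical_line[of t] WL by (simp add: s_def)
  ultimately show ?thesis
    using WL by (simp add: s_def exp_eq_polar)
qed

lemma continuous_on_phase: "continuous_on UNIV phase"
proof -
  have "1/2 - \<i> * of_real t \<notin> \<real>\<^sub>\<le>\<^sub>0" for t
    by (simp add: complex_nonpos_Reals_iff)
  moreover have "sin (of_real pi * (1/2 + \<i> * of_real t) / 2) \<notin> \<real>\<^sub>\<le>\<^sub>0" for t
    using Re_sin_critical_line_pos[of t] by (auto simp: complex_nonpos_Reals_iff)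
  ultimately show ?thesis
    unfolding phase_def[abs_def]
    by (intro continuous_intros continuous_on_compose2[OF continuous_on_ln_Gamma_complex[of "- \<real>\<^sub>\<le>\<^sub>0"]]) auto
qed

lemma phase_at_bot: "filterlim phase at_bot at_top"
proof (rule filterlim_at_bot_mono)
  \<comment> \<open>This is \<open>phase\<close> without its \<open>Arg\<close> term, which is at
    most pi.\<close>
  define f where "f t = t * ln (2 * pi) + Im (ln_Gamma (1/2 - \<i> * of_real t))" for t
  define f' where "f' t = ln (2 * pi) - Re (Digamma (1/2 + \<i> * of_real (- t)))" for t
  have deriv: "(f has_real_derivative f' t) (at t)" for t
  proof -
    have "((\<lambda>w. ln_Gamma (1/2 - \<i> * w)) has_field_derivative - \<i> * Digamma (1/2 - \<i> * of_real t)) (at (of_real t))"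
      by (auto intro!: derivative_eq_intros simp: complex_nonpos_Reals_iff)
    then have "((\<lambda>x. ln_Gamma (1/2 - \<i> * of_real x)) has_vector_derivative - \<i> * Digamma (1/2 - \<i> * of_real t)) (at t)"
      by (rule has_vector_derivative_real_field)
    then have "((\<lambda>x. Im (ln_Gamma (1/2 - \<i> * of_real x))) has_vector_derivative Im (- \<i> * Digamma (1/2 - \<i> * of_real t))) (at t)"
      by (rule bounded_linear.has_vector_derivative[OF bounded_linear_Im])
    then have "((\<lambda>x. Im (ln_Gamma (1/2 - \<i> * of_real x))) has_real_derivative - Re (Digamma (1/2 - \<i> * of_real t))) (at t)"
      by (simp add: has_real_derivative_iff_has_vector_derivative)
    then show ?thesis
      unfolding f_def[abs_def] f'_def 
      using DERIV_add[OF DERIV_cmult_right[OF DERIV_ident, of "ln (2 * pi)"]] by fastforce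
  qed
  \<comment> \<open>The threshold is what turns the harmonic bound on Digamma into
    \<open>f' t \<le> - 1\<close>.\<close>
  have "\<forall>\<^sub>F N in sequentially. harm N \<ge> 2 * (ln (2 * pi) + 1 - Digamma (1/2 :: real))"
    using harm_at_top by (simp add: filterlim_at_top)
  then obtain N where N: "harm N \<ge> 2 * (ln (2 * pi) + 1 - Digamma (1/2 :: real))"
    by (auto simp: eventually_sequentially)
  have "f' t \<le> - 1" if "t \<ge> real N" for t
    using Re_Digamma_ge_harm[of N "- t"] that N unfolding f'_def by simp
  moreover have "((\<lambda>t. pi + f t) has_real_derivative f' t) (at t)" for t
    using DERIV_add[OF DERIV_const deriv] by simp
  ultimately show "filterlim (\<lambda>t. pi + f t) at_bot at_top"
    by (rule filterlim_at_bot_if_deriv_le[rotated])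
  show "\<forall>\<^sub>F t in at_top. phase t \<le> pi + f t"
    using Arg_le_pi by (auto simp: phase_def f_def)
qed

theorem mainTheorem6:
  "W ` {1/2 + \<i> * of_real t | t :: real. True} = {w :: complex. cmod w = 1}"
proof (intro equalityI subsetI)
  fix w assume "w \<in> W ` {1/2 + \<i> * of_real t | t :: real. True}"
  then show "w \<in> {w. cmod w = 1}"
    by (auto simp: norm_W_critical_line)
next
  fix w :: complex assume "w \<in> {w. cmod w = 1}"
  then have "cis (Arg w) = w"
    using cis_Arg[of w] by (cases "w = 0") (auto simp: sgn_eq)
  then obtain \<theta> where \<theta>: "w = cis \<theta>"
    by metis
  \<comment> \<open>Enough full turns are subtracted from \<open>\<theta>\<close> to bring it below
    \<open>phase 0\<close>, where the descent of \<open>phase\<close> must meet it.\<close>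
  obtain n :: nat where "\<theta> - phase 0 < real n * (2 * pi)"
    using reals_Archimedean3[of "2 * pi"] by auto
  define \<theta>' where "\<theta>' = \<theta> - real n * (2 * pi)"
  have "cis (real n * (2 * pi)) = 1"
    using cis_multiple_2pi[of "real n"] by (simp add: mult_ac)
  then have w: "w = cis \<theta>'"
    by (simp add: \<theta> \<theta>'_def flip: cis_divide)
  have "\<forall>\<^sub>F t in at_top. phase t \<le> \<theta>' \<and> t \<ge> 0"
    using phase_at_bot eventually_ge_at_top[of 0] by (auto simp: filterlim_at_bot intro: eventually_conj)
  then obtain T where "phase T \<le> \<theta>'" "T \<ge> 0"
    by (auto dest: eventually_happens)
  moreover have "\<theta>' \<le> phase 0"
    using \<open>\<theta> - phase 0 < real n * (2 * pi)\<close> by (simp add: \<theta>'_def)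
  ultimately obtain t where "phase t = \<theta>'"
    using IVT2'[of phase T \<theta>' 0] continuous_on_subset[OF continuous_on_phase] by blast
  then have "W (1/2 + \<i> * of_real t) = w"
    by (simp add: W_critical_line_eq_cis w)
  then show "w \<in> W ` {1/2 + \<i> * of_real t | t :: real. True}"
    by blast
qed

end
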